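(* Suppose that $\nu$ and $\mu$ are rational numbers such that $0<\mu<1/4$ and $\mu<\nu<1$. Then there exist a positive integer $m$ with $\nu m,\mu m\in\mathbb{N}$ and a dataset $D=\{(x_i,y_i):i\in[m]\}\subset\mathcal{X}\times\{+1,-1\}$ of size $m$ with label ratio $r$ such that $\mu<r/2$ and $$\sup\{\mathrm{opt}(\nu,\mu;D')\,:\,D'\in\mathcal{D}_{\mu m+1}\}=\infty,$$ where $\mathcal{D}_{\mu m+1}$ is the family of contaminated datasets defined from $D$.
   Context: Let $\mathcal{X}$ be a (nonempty) input space and $\mathcal{H}$ a reproducing kernel Hilbert space (RKHS) of real functions on $\mathcal{X}$ with kernel $k:\mathcal{X}^2\to\mathbb{R}$ and norm $\|\cdot\|_{\mathcal{H}}$. Write $[m]=\{1,\ldots,m\}$. A dataset of size $m$ is a collection $D=\{(x_i,y_i):i\in[m]\}$ of labeled points of $\mathcal{X}\times\{+1,-1\}$ (repetitions are allowed and counted with multiplicity). Its label ratio is $$r=\frac1m\min\{\,|\{i:y_i=+1\}|,\ |\{i:y_i=-1\}|\,\}.$$ For a dataset $D$ of size $m$ and an integer $0\le\kappa\le m$, the family of contaminated datasets is $$\mathcal{D}_\kappa=\{D'=\{(x_i',y_i'):i\in[m]\}\subset\mathcal{X}\times\{+1,-1\}\,:\,|D'\cap D|\ge m-\kappa\},$$ i.e. all datasets of size $m$ having at least $m-\kappa$ elements in common with $D$ (equivalently, obtained from $D$ by replacing at most $\kappa$ of its samples by arbitrary labeled points). Let $E_\mu=\{(\eta_1,\ldots,\eta_m)^T\in\{0,1\}^m:\sum_{i=1}^m\eta_i\ge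 m(1-\mu)\}$. For a dataset $D=\{(x_i,y_i):i\in[m]\}$ and $\eta\in E_\mu$, define the reduced convex hulls $$\mathcal{U}_\eta^{\pm}[\nu,\mu;D]=\Big\{\sum_{i:y_i=\pm1}\gamma_i k(\cdot,x_i)\in\mathcal{H}\,:\,\sum_{i:y_i=\pm1}\gamma_i=1,\ 0\le\gamma_i\le\frac{2\eta_i}{(\nu-\mu)m}\ \text{for all } i \text{ with } y_i=\pm1\Big\},$$ the set $\mathcal{V}_\eta[\nu,\mu;D]=\{a-b: a\in\mathcal{U}_\eta^{+}[\nu,\mu;D],\ b\in\mathcal{U}_\eta^{-}[\nu,\mu;D]\}$, and $$\mathrm{opt}(\nu,\mu;D)=\max_{\eta\in E_\mu}\ \min_{f\in\mathcal{V}_\eta[\nu,\mu;D]}\|f\|_{\mathcal{H}}^2,$$ with the convention that the minimum over the empty set is $+\infty$. *)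

theory Defs
  imports "HOL-Analysis.Analysis" "HOL-Library.Multiset"
begin

(* The input space is the type 'x (types are nonempty).  A Hilbert space of functions is given by
   its carrier H and its inner product ip; nothing is assumed about ip outside H.
   The kernel section k(.,x) is the function %z. k z x. *)

definition rkhs_norm :: "(('x \<Rightarrow> real) \<Rightarrow> ('x \<Rightarrow> real) \<Rightarrow> real) \<Rightarrow> ('x \<Rightarrow> real) \<Rightarrow> real"
  where "rkhs_norm ip f = sqrt (ip f f)"

locale rkhs =
  fixes H :: "('x \<Rightarrow> real) set"
    and ip :: "('x \<Rightarrow> real) \<Rightarrow> ('x \<Rightarrow> real) \<Rightarrow> real"
    and k :: "'x \<Rightarrow> 'x \<Rightarrow> real"
  assumes zero_mem: "(\<lambda>_. 0) \<in> H"
    and add_mem: "\<lbrakk>f \<in> H; g \<in> H\<rbrakk> \<Longrightarrow> (\<lambda>z. f z + g z) \<in> H"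
    and scale_mem: "f \<in> H \<Longrightarrow> (\<lambda>z. c * f z) \<in> H"
    and ip_commute: "\<lbrakk>f \<in> H; g \<in> H\<rbrakk> \<Longrightarrow> ip f g = ip g f"
    and ip_add: "\<lbrakk>f \<in> H; g \<in> H; h \<in> H\<rbrakk> \<Longrightarrow> ip (\<lambda>z. f z + g z) h = ip f h + ip g h"
    and ip_scale: "\<lbrakk>f \<in> H; h \<in> H\<rbrakk> \<Longrightarrow> ip (\<lambda>z. c * f z) h = c * ip f h"
    and ip_nonneg: "f \<in> H \<Longrightarrow> 0 \<le> ip f f"
    and ip_definite: "\<lbrakk>f \<in> H; ip f f = 0\<rbrakk> \<Longrightarrow> f = (\<lambda>_. 0)"
    and complete: "\<And>s :: nat \<Rightarrow> 'x \<Rightarrow> real.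
      \<lbrakk>\<And>n. s n \<in> H;
       \<And>e. e > 0 \<Longrightarrow> \<exists>N. \<forall>i\<ge>N. \<forall>j\<ge>N. rkhs_norm ip (\<lambda>z. s i z - s j z) < e\<rbrakk>
      \<Longrightarrow> \<exists>f\<in>H. (\<lambda>n. rkhs_norm ip (\<lambda>z. s n z - f z)) \<longlonglongrightarrow> 0"
    and kernel_mem: "(\<lambda>z. k z x) \<in> H"
    and reproducing: "f \<in> H \<Longrightarrow> ip f (\<lambda>z. k z x) = f x"

type_synonym 'x dataset = "('x \<times> int) list"

(* Samples are indexed from 0, i.e. by i < m. *)

definition is_dataset :: "nat \<Rightarrow> 'x dataset \<Rightarrow> bool"
  where "is_dataset m D \<longleftrightarrow> length D = m \<and> (\<forall>(x, y) \<in> set D. y = 1 \<or> y = -1)"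

definition class_idx :: "int \<Rightarrow> 'x dataset \<Rightarrow> nat set"
  where "class_idx s D = {i. i < length D \<and> snd (D ! i) = s}"

definition label_ratio :: "'x dataset \<Rightarrow> real"
  where "label_ratio D =
    1 / real (length D) * real (min (card (class_idx 1 D)) (card (class_idx (-1) D)))"

(* The condition is |D' Int D| >= m - kappa for multisets, without truncated subtraction. *)

definition contaminated :: "nat \<Rightarrow> 'x dataset \<Rightarrow> 'x dataset set"
  where "contaminated \<kappa> D =
    {D'. is_dataset (length D) D' \<and> length D \<le> size (mset D' \<inter># mset D) + \<kappa>}"

definition outlier_masks :: "nat \<Rightarrow> real \<Rightarrow> nat list set"
  where "outlier_masks m \<mu> =
    {\<eta>. length \<eta> = m \<and> set \<eta> \<subseteq> {0, 1} \<and> real m * (1 - \<mu>) \<le> real (\<Sum>i<m. \<eta> ! i)}"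

definition reduced_hull ::
    "('x \<Rightarrow> 'x \<Rightarrow> real) \<Rightarrow> int \<Rightarrow> nat list \<Rightarrow> real \<Rightarrow> real \<Rightarrow> 'x dataset \<Rightarrow> ('x \<Rightarrow> real) set"
  where "reduced_hull k s \<eta> \<nu> \<mu> D =
    {(\<lambda>z. \<Sum>i\<in>class_idx s D. \<gamma> i * k z (fst (D ! i))) | \<gamma> :: nat \<Rightarrow> real.
       (\<Sum>i\<in>class_idx s D. \<gamma> i) = 1 \<and>
       (\<forall>i\<in>class_idx s D. 0 \<le> \<gamma> i \<and> \<gamma> i \<le> 2 * real (\<eta> ! i) / ((\<nu> - \<mu>) * real (length D)))}"

definition hull_diff ::
    "('x \<Rightarrow> 'x \<Rightarrow> real) \<Rightarrow> nat list \<Rightarrow> real \<Rightarrow> real \<Rightarrow> 'x dataset \<Rightarrow> ('x \<Rightarrow> real) set"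
  where "hull_diff k \<eta> \<nu> \<mu> D =
    {(\<lambda>z. a z - b z) | a b.
       a \<in> reduced_hull k 1 \<eta> \<nu> \<mu> D \<and> b \<in> reduced_hull k (-1) \<eta> \<nu> \<mu> D}"

(* The infimum in ereal is \<infinity> on the empty set; otherwise it is attained, see hull_diff_min. *)

definition opt ::
    "(('x \<Rightarrow> real) \<Rightarrow> ('x \<Rightarrow> real) \<Rightarrow> real) \<Rightarrow> ('x \<Rightarrow> 'x \<Rightarrow> real)
      \<Rightarrow> real \<Rightarrow> real \<Rightarrow> 'x dataset \<Rightarrow> ereal"
  where "opt ip k \<nu> \<mu> D =
    Max ((\<lambda>\<eta>. INF f\<in>hull_diff k \<eta> \<nu> \<mu> D. ereal ((rkhs_norm ip f)\<^sup>2)) ` outlier_masks (length D) \<mu>)"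

lemma finite_outlier_masks: "finite (outlier_masks m \<mu>)"
proof (rule finite_subset)
  show "outlier_masks m \<mu> \<subseteq> {\<eta>. set \<eta> \<subseteq> {0, 1} \<and> length \<eta> = m}"
    by (auto simp: outlier_masks_def)
qed (rule finite_lists_length_eq, simp)

lemma outlier_masks_nonempty:
  assumes "0 \<le> \<mu>"
  shows "outlier_masks m \<mu> \<noteq> {}"
proof -
  have "replicate m 1 \<in> outlier_masks m \<mu>"
    using assms by (auto simp: outlier_masks_def algebra_simps)
  then show ?thesis by blast
qed

lemma finite_class_idx: "finite (class_idx s D)"
  by (simp add: class_idx_def)

context rkhs
begin

lemma sum_mem:
  assumes "finite I"
  shows "(\<lambda>z. \<Sum>i\<in>I. c i * k z (x i)) \<in> H"
  using assms
proof (induction I rule: finite_induct)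
  case empty
  then show ?case by (simp add: zero_mem)
next
  case (insert i I)
  then show ?case
    using add_mem[OF scale_mem[OF kernel_mem] insert.IH] by simp
qed

lemma ip_sum:
  assumes "finite I" "h \<in> H"
  shows "ip (\<lambda>z. \<Sum>i\<in>I. c i * k z (x i)) h = (\<Sum>i\<in>I. c i * h (x i))"
  using assms
proof (induction I rule: finite_induct)
  case empty
  then show ?case using ip_scale[OF zero_mem, of h 0] by simp
next
  case (insert i I)
  have "ip (\<lambda>z. k z (x i)) h = h (x i)"
    using ip_commute[OF kernel_mem insert.prems] reproducing[OF insert.prems] by simp
  then show ?case
    using insert ip_add[OF scale_mem[OF kernel_mem] sum_mem[OF insert.hyps(1)] insert.prems]
      ip_scale[OF kernel_mem insert.prems] by simp
qed

lemma reduced_hull_subset: "reduced_hull k s \<eta> \<nu> \<mu> D \<subseteq> H"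
  unfolding reduced_hull_def by (auto intro!: sum_mem finite_class_idx)

lemma diff_mem: "\<lbrakk>f \<in> H; g \<in> H\<rbrakk> \<Longrightarrow> (\<lambda>z. f z - g z) \<in> H"
  using add_mem[OF _ scale_mem[of g "-1"], of f] by simp

lemma hull_diff_subset: "hull_diff k \<eta> \<nu> \<mu> D \<subseteq> H"
  using reduced_hull_subset unfolding hull_diff_def by (blast intro: diff_mem)

lemma hull_diff_min:
  assumes ne: "hull_diff k \<eta> \<nu> \<mu> D \<noteq> {}"
  shows "\<exists>f\<in>hull_diff k \<eta> \<nu> \<mu> D. \<forall>g\<in>hull_diff k \<eta> \<nu> \<mu> D. (rkhs_norm ip f)\<^sup>2 \<le> (rkhs_norm ip g)\<^sup>2"
proof -
  define P where "P = class_idx 1 D"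
  define N where "N = class_idx (-1) D"
  define I where "I = P \<union> N"
  define u where "u i = 2 * real (\<eta> ! i) / ((\<nu> - \<mu>) * real (length D))" for i
  define xx where "xx i = fst (D ! i)" for i
  define sg where "sg i = (if i \<in> P then 1 else -1::real)" for i
  define F where "F \<gamma> = (\<lambda>z. \<Sum>i\<in>I. (sg i * \<gamma> i) * k z (xx i))" for \<gamma> :: "nat \<Rightarrow> real"
  define B where "B = (PiE UNIV (\<lambda>i. if i \<in> I then {0..u i} else {0}))"
  define C where "C = {\<gamma> \<in> B. (\<Sum>i\<in>P. \<gamma> i) = 1 \<and> (\<Sum>i\<in>N. \<gamma> i) = 1}"
  have fin: "finite P" "finite N" "finite I" and disj: "P \<inter> N = {}"
    by (auto simp: P_def N_def I_def class_idx_def)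
  have cont: "continuous_on A (\<lambda>\<gamma>::nat \<Rightarrow> real. \<gamma> i)" for A i
    by (rule continuous_on_subset[OF continuous_on_product_coordinates]) auto
  have "compactin (product_topology (\<lambda>_. euclidean) UNIV) B"
    unfolding B_def by (subst compactin_PiE) auto
  then have "compact B"
    by (simp add: euclidean_product_topology)
  moreover have "closed {\<gamma>. (\<Sum>i\<in>P. \<gamma> i) = (1::real) \<and> (\<Sum>i\<in>N. \<gamma> i) = (1::real)}"
    by (intro closed_Collect_conj closed_Collect_eq continuous_on_sum cont continuous_on_const)
  ultimately have "compact C"
    using compact_Int_closed unfolding C_def by (simp add: Collect_conj_eq)
  have split: "F \<gamma> = (\<lambda>z. (\<Sum>i\<in>P. \<gamma> i * k z (xx i)) - (\<Sum>i\<in>N. \<gamma> i * k z (xx i)))" for \<gamma>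
  proof
    fix z
    have "(\<Sum>i\<in>P. (sg i * \<gamma> i) * k z (xx i)) = (\<Sum>i\<in>P. \<gamma> i * k z (xx i))"
      by (rule sum.cong) (auto simp: sg_def)
    moreover have "(\<Sum>i\<in>N. (sg i * \<gamma> i) * k z (xx i)) = - (\<Sum>i\<in>N. \<gamma> i * k z (xx i))"
      unfolding sum_negf[symmetric] using disj by (intro sum.cong) (auto simp: sg_def)
    ultimately show "F \<gamma> z = (\<Sum>i\<in>P. \<gamma> i * k z (xx i)) - (\<Sum>i\<in>N. \<gamma> i * k z (xx i))"
      unfolding F_def I_def by (simp add: sum.union_disjoint[OF fin(1,2) disj])
  qed
  have img: "hull_diff k \<eta> \<nu> \<mu> D = F ` C"
  proof (intro equalityI subsetI)
    fix f assume "f \<in> hull_diff k \<eta> \<nu> \<mu> D"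
    then obtain a b where f: "f = (\<lambda>z. (\<Sum>i\<in>P. a i * k z (xx i)) - (\<Sum>i\<in>N. b i * k z (xx i)))"
      and a: "(\<Sum>i\<in>P. a i) = 1" "\<forall>i\<in>P. 0 \<le> a i \<and> a i \<le> u i"
      and b: "(\<Sum>i\<in>N. b i) = 1" "\<forall>i\<in>N. 0 \<le> b i \<and> b i \<le> u i"
      unfolding hull_diff_def reduced_hull_def P_def N_def u_def xx_def by blast
    define g where "g i = (if i \<in> P then a i else if i \<in> N then b i else 0)" for i
    have gN: "g i = b i" if "i \<in> N" for i using that disj by (auto simp: g_def)
    have "g \<in> C"
      using a b gN by (auto simp: C_def B_def I_def g_def PiE_def)
    moreover have "f = F g"
      unfolding split f by (simp add: gN cong: sum.cong) (simp add: g_def cong: sum.cong)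
    ultimately show "f \<in> F ` C" by blast
  next
    fix f assume "f \<in> F ` C"
    then obtain g where g: "g \<in> C" "f = F g" by blast
    have "g i \<in> (if i \<in> I then {0..u i} else {0})" for i
      using g(1) unfolding C_def B_def PiE_def Pi_def by blast
    then have "\<forall>i\<in>P \<union> N. 0 \<le> g i \<and> g i \<le> u i"
      unfolding I_def by (metis atLeastAtMost_iff)
    then have "(\<lambda>z. \<Sum>i\<in>P. g i * k z (xx i)) \<in> reduced_hull k 1 \<eta> \<nu> \<mu> D"
      and "(\<lambda>z. \<Sum>i\<in>N. g i * k z (xx i)) \<in> reduced_hull k (-1) \<eta> \<nu> \<mu> D"
      using g(1) unfolding reduced_hull_def C_def P_def[symmetric] N_def[symmetric]
        u_def[symmetric] xx_def[symmetric] by blast+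
    then show "f \<in> hull_diff k \<eta> \<nu> \<mu> D"
      unfolding hull_diff_def g(2) split mem_Collect_eq by (intro exI conjI) (rule refl)
  qed
  have FH: "F \<gamma> \<in> H" for \<gamma>
    unfolding F_def by (rule sum_mem[OF fin(3)])
  have nrm: "(rkhs_norm ip (F \<gamma>))\<^sup>2
      = (\<Sum>i\<in>I. (sg i * \<gamma> i) * (\<Sum>j\<in>I. (sg j * \<gamma> j) * k (xx i) (xx j)))" for \<gamma>
  proof -
    have "(rkhs_norm ip (F \<gamma>))\<^sup>2 = ip (F \<gamma>) (F \<gamma>)"
      by (simp add: rkhs_norm_def ip_nonneg[OF FH])
    also have "\<dots> = (\<Sum>i\<in>I. (sg i * \<gamma> i) * F \<gamma> (xx i))"
      using ip_sum[OF fin(3) FH, of "\<lambda>i. sg i * \<gamma> i" xx \<gamma>] by (simp add: F_def)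
    finally show ?thesis by (simp add: F_def)
  qed
  have "continuous_on C (\<lambda>\<gamma>. (rkhs_norm ip (F \<gamma>))\<^sup>2)"
    unfolding nrm by (intro continuous_on_sum continuous_on_mult cont continuous_on_const)
  moreover have "C \<noteq> {}" using ne img by auto
  ultimately show ?thesis
    using continuous_attains_inf[OF \<open>compact C\<close>] unfolding img by blast
qed

end

end

(* Kernel values play no role: the optimum is infinite as soon as an admissible mask discards a
   whole class.  If the minority class has 2 \<mu> m + 1 samples, the label ratio exceeds 2 \<mu>; an
   adversary flips \<mu> m + 1 of them, and the mask discards the remaining \<mu> m. *)

theory Submission
  imports Defs
begin

text \<open>The mask caps every weight of the class at 0, so the weights sum to 0 instead of 1. A
  class without samples is covered as well, its sum being empty.\<close>

lemma reduced_hull_eq_empty: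
  assumes "\<And>i. i \<in> class_idx s D \<Longrightarrow> \<eta> ! i = 0"
  shows "reduced_hull k s \<eta> \<nu> \<mu> D = {}"
proof -
  have False
    if sum: "(\<Sum>i\<in>class_idx s D. \<gamma> i) = 1"
      and bd: "\<forall>i\<in>class_idx s D. 0 \<le> \<gamma> i \<and> \<gamma> i \<le> 2 * real (\<eta> ! i) / ((\<nu> - \<mu>) * real (length D))"
    for \<gamma> :: "nat \<Rightarrow> real"
  proof -
    have "\<gamma> i = 0" if "i \<in> class_idx s D" for i
      using bd that assms[OF that] by force
    then show False using sum by simp
  qed
  then show ?thesis unfolding reduced_hull_def by blast
qed

text \<open>A single mask is enough because \<open>opt\<close> is a maximum over masks: with one
  hull empty there is no difference vector, and the infimum over the empty set is
  \<infinity>.\<close>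

lemma opt_eq_infinity:
  assumes "\<eta> \<in> outlier_masks (length D) \<mu>"
    and "\<And>i. i \<in> class_idx 1 D \<Longrightarrow> \<eta> ! i = 0"
  shows "opt ip k \<nu> \<mu> D = \<infinity>"
proof -
  have "hull_diff k \<eta> \<nu> \<mu> D = {}"
    by (simp add: hull_diff_def reduced_hull_eq_empty[where s = 1, OF assms(2)])
  then have "(INF f\<in>hull_diff k \<eta> \<nu> \<mu> D. ereal ((rkhs_norm ip f)\<^sup>2)) = \<infinity>"
    by (simp add: top_ereal_def)
  then have "\<infinity> \<in> (\<lambda>\<eta>. INF f\<in>hull_diff k \<eta> \<nu> \<mu> D. ereal ((rkhs_norm ip f)\<^sup>2))
      ` outlier_masks (length D) \<mu>"
    using assms(1) by (rule image_eqI[OF sym])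
  then have "\<infinity> \<le> opt ip k \<nu> \<mu> D"
    unfolding opt_def by (intro Max_ge finite_imageI finite_outlier_masks)
  then show ?thesis by simp
qed

text \<open>The mask keeps \<open>m - q\<close> samples, and \<open>m - q\<close> \<ge>
  \<open>m * (1 - \<mu>)\<close> is the bound on \<open>q\<close> rearranged.\<close>

lemma prefix_mask_mem_outlier_masks:
  assumes "q \<le> m" "real q \<le> \<mu> * real m"
  shows "replicate q 0 @ replicate (m - q) 1 \<in> outlier_masks m \<mu>"
proof -
  let ?\<eta> = "replicate q 0 @ replicate (m - q) (1::nat)"
  have len: "length ?\<eta> = m" using assms(1) by simp
  have "(\<Sum>i<m. ?\<eta> ! i) = sum_list ?\<eta>"
    unfolding sum_list_sum_nth len by (simp add: lessThan_atLeast0)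
  also have "\<dots> = m - q" by (simp add: sum_list_replicate)
  finally have "real m * (1 - \<mu>) \<le> real (\<Sum>i<m. ?\<eta> ! i)"
    using assms by (simp only: of_nat_diff) (simp add: algebra_simps)
  with len show ?thesis by (auto simp: outlier_masks_def simp del: of_nat_sum)
qed

text \<open>Listing the positive samples first makes each class an interval of indices, so a prefix
  mask can discard exactly the positive class. Repeating one point is legitimate since samples count
  with multiplicity.\<close>

definition block_dataset :: "'x \<Rightarrow> nat \<Rightarrow> nat \<Rightarrow> 'x dataset"
  where "block_dataset x a b = replicate a (x, 1) @ replicate b (x, -1)"

lemma length_block_dataset: "length (block_dataset x a b) = a + b"
  by (simp add: block_dataset_def)

lemma is_dataset_block_dataset: "is_dataset (a + b) (block_dataset x a b)"
  by (auto simp: is_dataset_def block_dataset_def)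

lemma snd_nth_block_dataset:
  assumes "i < a + b"
  shows "snd (block_dataset x a b ! i) = (if i < a then 1 else -1)"
proof (cases "i < a")
  case False
  with assms have "i - a < b" by linarith
  with False show ?thesis by (simp add: block_dataset_def nth_append)
qed (simp add: block_dataset_def nth_append)

lemma class_idx_block_dataset:
  "class_idx 1 (block_dataset x a b) = {..<a}"
  "class_idx (-1) (block_dataset x a b) = {a..<a + b}"
  by (auto simp: class_idx_def length_block_dataset snd_nth_block_dataset split: if_splits)

lemma label_ratio_block_dataset:
  "label_ratio (block_dataset x a b) = real (min a b) / real (a + b)"
  by (simp add: label_ratio_def class_idx_block_dataset length_block_dataset)

text \<open>Flipping \<open>c\<close> positive labels leaves \<open>a\<close> positive and
  \<open>b\<close> negative samples untouched; this common part is \<open>?M\<close>.\<close>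

lemma block_dataset_contaminated:
  "block_dataset x a (b + c) \<in> contaminated c (block_dataset x (a + c) b)"
proof -
  let ?M = "mset (block_dataset x a b)"
  have "?M \<subseteq># mset (block_dataset x a (b + c)) \<inter># mset (block_dataset x (a + c) b)"
    by (auto simp: block_dataset_def subseteq_mset_def)
  from size_mset_mono[OF this]
  have "a + b \<le> size (mset (block_dataset x a (b + c)) \<inter># mset (block_dataset x (a + c) b))"
    by (simp add: length_block_dataset)
  then show ?thesis
    using is_dataset_block_dataset[of a "b + c" x]
    by (simp add: contaminated_def length_block_dataset ac_simps)
qed

lemma opt_block_dataset_eq_infinity:
  assumes "real a \<le> \<mu> * real (a + b)"
  shows "opt ip k \<nu> \<mu> (block_dataset x a b) = \<infinity>"
proof (rule opt_eq_infinity)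
  show "replicate a 0 @ replicate (a + b - a) 1
      \<in> outlier_masks (length (block_dataset x a b)) \<mu>"
    unfolding length_block_dataset using assms by (intro prefix_mask_mem_outlier_masks) auto
qed (simp add: class_idx_block_dataset nth_append)

text \<open>The product of the two denominators serves both numbers; nonnegativity removes the
  absolute values.\<close>

lemma nonneg_Rats_common_denominator:
  fixes u v :: real
  assumes "u \<in> \<rat>" "v \<in> \<rat>" "0 \<le> u" "0 \<le> v"
  obtains n p q :: nat where "0 < n" "u * real n = real p" "v * real n = real q"
proof -
  obtain a b :: nat where u: "b \<noteq> 0" "\<bar>u\<bar> = real a / real b"
    using Rats_abs_nat_div_natE[OF assms(1)] by metis
  obtain c d :: nat where v: "d \<noteq> 0" "\<bar>v\<bar> = real c / real d"
    using Rats_abs_nat_div_natE[OF assms(2)] by metis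
  show thesis
    using u v assms(3,4) by (intro that[of "b * d" "a * d" "c * b"]) auto
qed

theorem theorem2:
  fixes H :: "('x \<Rightarrow> real) set"
    and ip :: "('x \<Rightarrow> real) \<Rightarrow> ('x \<Rightarrow> real) \<Rightarrow> real"
    and k :: "'x \<Rightarrow> 'x \<Rightarrow> real"
    and \<nu> \<mu> :: real
  assumes "rkhs H ip k"
    and "\<nu> \<in> \<rat>" and "\<mu> \<in> \<rat>"
    and "0 < \<mu>" and "\<mu> < 1 / 4"
    and "\<mu> < \<nu>" and "\<nu> < 1"
  shows "\<exists>(m::nat) (p::nat) (q::nat) (D :: 'x dataset).
    0 < m \<and> \<nu> * real m = real p \<and> \<mu> * real m = real q \<and>
    is_dataset m D \<and> \<mu> < label_ratio D / 2 \<and>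
    (SUP D'\<in>contaminated (q + 1) D. opt ip k \<nu> \<mu> D') = \<infinity>"
proof -
  obtain n p' q' :: nat where n: "0 < n" "\<nu> * real n = real p'" "\<mu> * real n = real q'"
    using nonneg_Rats_common_denominator[of \<nu> \<mu>] assms by auto
  (* Doubling the denominator leaves room for 2 q + 1 samples in each class. *)
  define m p q where "m = 2 * n" and "p = 2 * p'" and "q = 2 * q'"
  have m: "0 < m" "\<nu> * real m = real p" "\<mu> * real m = real q"
    using n by (auto simp: m_def p_def q_def)
  have "4 * q' < n"
  proof -
    have "\<mu> * real n < 1 / 4 * real n"
      using assms(5) n(1) by (intro mult_strict_right_mono) auto
    then show ?thesis using n(3) by simp
  qed
  \<comment> \<open>By integrality \<open>n\<close> \<ge> \<open>4 * q' + 1\<close>, and doubling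
    gives \<open>m\<close> \<ge> \<open>4 * q + 2\<close>: the negative class is at least as large
    as a positive class of \<open>2 * q + 1\<close>.\<close>
  then obtain b where b: "m = 2 * q + 1 + b" "2 * q + 1 \<le> b"
    by (intro that[of "m - (2 * q + 1)"]) (auto simp: m_def q_def)
  define x :: 'x where "x = undefined"
  \<comment> \<open>The summand \<open>q\<close> counts the positive samples that survive,
    \<open>q + 1\<close> those that the adversary flips.\<close>
  define D where "D = block_dataset x (q + (q + 1)) b"
  define D' where "D' = block_dataset x q (b + (q + 1))"
  have "is_dataset m D"
    using is_dataset_block_dataset[of "q + (q + 1)" b x] by (simp add: D_def b(1) mult_2)
  moreover have "\<mu> < label_ratio D / 2"
  proof -
    have ratio: "label_ratio D = real (2 * q + 1) / real m"
      using b by (simp add: D_def label_ratio_block_dataset min_def)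
    \<comment> \<open>Since \<open>\<mu> * m = q\<close>, the one sample beyond \<open>2 * q\<close>
      makes the inequality strict.\<close>
    have "2 * \<mu> * real m < real (2 * q + 1)"
      using m(3) by simp
    then have "2 * \<mu> < label_ratio D"
      unfolding ratio using m(1) by (subst pos_less_divide_eq) simp_all
    then show ?thesis by simp
  qed
  moreover have "(SUP D'\<in>contaminated (q + 1) D. opt ip k \<nu> \<mu> D') = \<infinity>"
  proof -
    \<comment> \<open>The size is still \<open>m\<close>, so the \<open>q\<close> positive samples
      left in \<open>D'\<close> are exactly as many as a mask may discard.\<close>
    have "q + (b + (q + 1)) = m" using b(1) by simp
    then have "opt ip k \<nu> \<mu> D' = \<infinity>"
      unfolding D'_def using m(3) by (intro opt_block_dataset_eq_infinity) simp
    moreover have "D' \<in> contaminated (q + 1) D"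
      unfolding D_def D'_def by (rule block_dataset_contaminated)
    ultimately have "\<infinity> \<le> (SUP D'\<in>contaminated (q + 1) D. opt ip k \<nu> \<mu> D')"
      by (metis SUP_upper)
    then show ?thesis by simp
  qed
  ultimately show ?thesis using m by blast
qed

end
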